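(* Let $V$ be a finite-dimensional vector space over a field and let $A : V \to V$ be a nilpotent linear transformation. Then $V$ is a direct sum of cyclic subspaces (with respect to $A$).
   Context: For a nilpotent linear transformation $A : V \to V$, a cyclic subspace of $V$ (with respect to $A$) is an $A$-invariant subspace spanned by $v, Av, \dots, A^{n-1}v$ for some nonzero vector $v \in V$, where $n$ is the smallest positive integer with $A^n v = 0$. (For $V = 0$ the direct sum is the empty one.) *)

theory Defs
  imports Complex_Main "HOL-Library.FuncSet"
begin

definition nilpotent_map :: "('b::zero \<Rightarrow> 'b) \<Rightarrow> bool" where
  "nilpotent_map A \<longleftrightarrow> (\<exists>n. \<forall>x. (A ^^ n) x = 0)"

context vector_space
begin

definition cyclic_subspace :: "('b \<Rightarrow> 'b) \<Rightarrow> 'b set \<Rightarrow> bool" where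
  "cyclic_subspace A W \<longleftrightarrow>
     subspace W \<and> A ` W \<subseteq> W \<and>
     (\<exists>v n. v \<noteq> 0 \<and> 0 < n \<and> (A ^^ n) v = 0 \<and> (\<forall>m. 0 < m \<and> m < n \<longrightarrow> (A ^^ m) v \<noteq> 0) \<and>
            W = span ((\<lambda>i. (A ^^ i) v) ` {..<n}))"

(* Internal direct sum of a finite family. Taking w in the extensional product makes the
   uniqueness refer only to the values of w on I. For I = {} it says V = {0}. *)
definition direct_sum :: "'b set \<Rightarrow> 'i set \<Rightarrow> ('i \<Rightarrow> 'b set) \<Rightarrow> bool" where
  "direct_sum V I W \<longleftrightarrow>
     finite I \<and> subspace V \<and> (\<forall>i\<in>I. subspace (W i) \<and> W i \<subseteq> V) \<and>
     (\<forall>x\<in>V. \<exists>!w. w \<in> Pi\<^sub>E I W \<and> x = (\<Sum>i\<in>I. w i))"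

end

end

theory Submission
  imports Defs
begin

text \<open>
  The cyclic subspaces are read off from a generating set of least total length. The \<^emph>\<open>order\<close> of a
  vector \<open>v\<close> is the least \<open>n\<close> with \<open>A\<^sup>n v = 0\<close>. Among the finite sets \<open>S\<close> of nonzero vectors
  whose \<open>A\<close>-orbits together span \<open>V\<close> (a basis is one), take one that minimises the sum of the
  orders of its members. The cyclic subspaces \<open>C\<^sub>v\<close> for \<open>v \<in> S\<close> then span \<open>V\<close>, and the claim is that
  their sum is direct.

  Suppose that it is not: \<open>\<Sum> u\<^sub>v = 0\<close> with \<open>u\<^sub>v \<in> C\<^sub>v\<close> not all zero. Since \<open>A\<close> is nilpotent, there is a
  largest \<open>a\<close> such that every \<open>u\<^sub>v\<close> lies in \<open>A\<^sup>a C\<^sub>v\<close>. Write \<open>u\<^sub>v = A\<^sup>a y\<^sub>v\<close> with \<open>y\<^sub>v \<in> C\<^sub>v\<close>, choose \<open>j \<in> S\<close>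
  with \<open>u\<^sub>j \<notin> A\<^sup>a\<^sup>+\<^sup>1 C\<^sub>j\<close>, and replace \<open>j\<close> in \<open>S\<close> by \<open>v' = \<Sum> y\<^sub>v\<close>.

  \<^item> The new vector is shorter: \<open>A\<^sup>a v' = \<Sum> u\<^sub>v = 0\<close>, whereas \<open>j\<close> has order larger than \<open>a\<close> because
    \<open>A\<^sup>a C\<^sub>j\<close> contains \<open>u\<^sub>j \<noteq> 0\<close>.
  \<^item> Nothing is lost: the invariant subspace \<open>M\<close> generated by the new set contains \<open>y\<^sub>j\<close>, because it
    contains \<open>v'\<close> and the other \<open>y\<^sub>v\<close>. Now \<open>y\<^sub>j \<notin> A C\<^sub>j\<close>, and a vector of \<open>C\<^sub>j\<close> outside \<open>A C\<^sub>j\<close>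
    generates \<open>C\<^sub>j\<close>; this is Nakayama's lemma for the nilpotent \<open>A\<close> (lemma
    \<open>orbit_span_subset_if_not_in_image\<close>). So \<open>M\<close> contains \<open>j\<close> and is all of \<open>V\<close>.

  This contradicts minimality (lemma \<open>shorter_generating_set\<close>).
\<close>

section \<open>Direct sums\<close>

context vector_space
begin

lemma span_UN_sumE:
  assumes "finite S" and "x \<in> span (\<Union>v\<in>S. B v)"
  obtains w where "\<And>v. v \<in> S \<Longrightarrow> w v \<in> span (B v)" and "x = (\<Sum>v\<in>S. w v)"
proof -
  have "\<exists>w. (\<forall>v\<in>S. w v \<in> span (B v)) \<and> x = (\<Sum>v\<in>S. w v)"
    using assms
  proof (induction S arbitrary: x rule: finite_induct)
    case empty
    then show ?case by simp
  next
    case (insert s S)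
    then obtain y z where yz: "x = y + z" "y \<in> span (B s)" "z \<in> span (\<Union>v\<in>S. B v)"
      by (auto simp: span_Un)
    with insert.IH obtain w where w: "\<forall>v\<in>S. w v \<in> span (B v)" "z = (\<Sum>v\<in>S. w v)"
      by blast
    have "(\<Sum>v\<in>S. (w(s := y)) v) = (\<Sum>v\<in>S. w v)"
      using insert.hyps by (intro sum.cong) auto
    with insert.hyps yz w show ?case
      by (intro exI[of _ "w(s := y)"]) auto
  qed
  with that show thesis by blast
qed

lemma direct_sumI:
  assumes "finite I" and "subspace V" and sub: "\<And>i. i \<in> I \<Longrightarrow> subspace (W i) \<and> W i \<subseteq> V"
    and ex: "\<And>x. x \<in> V \<Longrightarrow> \<exists>w. (\<forall>i\<in>I. w i \<in> W i) \<and> x = (\<Sum>i\<in>I. w i)"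
    and zero: "\<And>u i. (\<And>i. i \<in> I \<Longrightarrow> u i \<in> W i) \<Longrightarrow> (\<Sum>i\<in>I. u i) = 0 \<Longrightarrow> i \<in> I \<Longrightarrow> u i = 0"
  shows "direct_sum V I W"
  unfolding direct_sum_def
proof (intro conjI ballI)
  fix x assume "x \<in> V"
  then obtain w where w: "\<forall>i\<in>I. w i \<in> W i" "x = (\<Sum>i\<in>I. w i)"
    using ex by blast
  show "\<exists>!w. w \<in> Pi\<^sub>E I W \<and> x = (\<Sum>i\<in>I. w i)"
  proof (rule ex_ex1I)
    show "\<exists>w. w \<in> Pi\<^sub>E I W \<and> x = (\<Sum>i\<in>I. w i)"
      using w by (intro exI[of _ "restrict w I"]) auto
  next
    fix w1 w2
    assume 1: "w1 \<in> Pi\<^sub>E I W \<and> x = (\<Sum>i\<in>I. w1 i)" and 2: "w2 \<in> Pi\<^sub>E I W \<and> x = (\<Sum>i\<in>I. w2 i)"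
    have "w1 i - w2 i = 0" if "i \<in> I" for i
    proof (rule zero[OF _ _ that])
      show "w1 i - w2 i \<in> W i" if "i \<in> I" for i
        using 1 2 that sub[OF that] by (blast intro: subspace_diff)
      show "(\<Sum>i\<in>I. w1 i - w2 i) = 0"
        using 1 2 by (simp add: sum_subtractf)
    qed
    with 1 2 show "w1 = w2"
      by (intro PiE_ext[of w1 I W w2]) auto
  qed
qed (use assms in auto)

end

section \<open>Orbits of a nilpotent map\<close>

locale nilpotent_endomorphism = vector_space scale
  for scale :: "'a::field \<Rightarrow> 'b::ab_group_add \<Rightarrow> 'b" (infixr \<open>*s\<close> 75) +
  fixes A :: "'b \<Rightarrow> 'b"
  assumes linear_A: "Vector_Spaces.linear scale scale A"
    and nilpotent_A: "nilpotent_map A"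
begin

lemma linear_funpow: "Vector_Spaces.linear scale scale (A ^^ n)"
proof (induction n)
  case 0
  show ?case using linear_id by (simp add: id_def)
next
  case (Suc n)
  then show ?case
    using linear_A unfolding funpow.simps(2) by (rule Vector_Spaces.linear_compose)
qed

sublocale pow: Vector_Spaces.linear scale scale "A ^^ n" for n
  by (rule linear_funpow)

sublocale A: Vector_Spaces.linear scale scale A
  by (rule linear_A)

text \<open>
  The orbit runs over all powers of \<open>A\<close>, including those that annihilate \<open>v\<close>, so that it is
  invariant under \<open>A\<close> by its very form.
\<close>

definition orbit :: "'b \<Rightarrow> 'b set" where
  "orbit v = range (\<lambda>i. (A ^^ i) v)"

definition nilorder :: "'b \<Rightarrow> nat" where
  "nilorder v = (LEAST n. (A ^^ n) v = 0)"

lemma funpow_nilorder: "(A ^^ nilorder v) v = 0"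
proof -
  from nilpotent_A obtain n where "(A ^^ n) v = 0"
    by (auto simp: nilpotent_map_def)
  then show ?thesis
    unfolding nilorder_def by (rule LeastI)
qed

lemma nilorder_le: "(A ^^ n) v = 0 \<Longrightarrow> nilorder v \<le> n"
  unfolding nilorder_def by (rule Least_le)

lemma funpow_eq_0_if_nilorder_le:
  assumes "nilorder v \<le> n"
  shows "(A ^^ n) v = 0"
proof -
  have "(A ^^ n) v = (A ^^ (n - nilorder v)) ((A ^^ nilorder v) v)"
    using assms by (simp flip: funpow_add[unfolded fun_eq_iff comp_apply, rule_format])
  then show ?thesis
    by (simp add: funpow_nilorder pow.zero)
qed

lemma funpow_in_orbit: "(A ^^ i) v \<in> orbit v"
  by (simp add: orbit_def)

lemma self_in_orbit_span: "v \<in> span (orbit v)"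
  using funpow_in_orbit[of 0 v] by (simp add: span_base)

text \<open>Any union of orbits is mapped into itself, and \<open>A\<close> is linear.\<close>

lemma funpow_in_span_orbits:
  assumes "x \<in> span (\<Union>v\<in>S. orbit v)"
  shows "(A ^^ n) x \<in> span (\<Union>v\<in>S. orbit v)"
proof -
  have "(A ^^ n) ` (\<Union>v\<in>S. orbit v) \<subseteq> (\<Union>v\<in>S. orbit v)"
    by (auto simp: orbit_def simp flip: funpow_add[unfolded fun_eq_iff comp_apply, rule_format])
  then have "span ((A ^^ n) ` (\<Union>v\<in>S. orbit v)) \<subseteq> span (\<Union>v\<in>S. orbit v)"
    by (rule span_mono)
  then show ?thesis
    using assms by (auto simp: pow.span_image)
qed

lemma funpow_in_orbit_span: "x \<in> span (orbit v) \<Longrightarrow> (A ^^ n) x \<in> span (orbit v)"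
  using funpow_in_span_orbits[of x "{v}"] by simp

lemma image_in_orbit_span: "x \<in> span (orbit v) \<Longrightarrow> A x \<in> span (orbit v)"
  using funpow_in_orbit_span[of x v 1] by simp

lemma funpow_orbit_span_eq_0:
  assumes "x \<in> span (orbit v)" and "nilorder v \<le> n"
  shows "(A ^^ n) x = 0"
  using assms(1)
proof (rule pow.eq_0_on_span[rotated])
  fix y assume "y \<in> orbit v"
  then obtain i where "y = (A ^^ i) v"
    by (auto simp: orbit_def)
  then have "(A ^^ n) y = (A ^^ (n + i)) v"
    by (simp add: funpow_add)
  with assms(2) show "(A ^^ n) y = 0"
    by (simp add: funpow_eq_0_if_nilorder_le)
qed

lemma cyclic_subspace_orbit_span:
  assumes "v \<noteq> 0"
  shows "cyclic_subspace A (span (orbit v))"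
  unfolding cyclic_subspace_def
proof (intro conjI exI)
  show "0 < nilorder v"
    using funpow_nilorder[of v] assms by (cases "nilorder v") auto
  show "\<forall>m. 0 < m \<and> m < nilorder v \<longrightarrow> (A ^^ m) v \<noteq> 0"
    using nilorder_le by (meson not_le)
  have "orbit v \<subseteq> insert 0 ((\<lambda>i. (A ^^ i) v) ` {..<nilorder v})"
  proof
    fix y assume "y \<in> orbit v"
    then obtain i where "y = (A ^^ i) v"
      by (auto simp: orbit_def)
    then show "y \<in> insert 0 ((\<lambda>i. (A ^^ i) v) ` {..<nilorder v})"
      by (cases "i < nilorder v") (auto simp: funpow_eq_0_if_nilorder_le)
  qed
  then have "span (orbit v) \<subseteq> span (insert 0 ((\<lambda>i. (A ^^ i) v) ` {..<nilorder v}))"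
    by (rule span_mono)
  moreover have "span ((\<lambda>i. (A ^^ i) v) ` {..<nilorder v}) \<subseteq> span (orbit v)"
    by (intro span_mono) (auto simp: orbit_def)
  ultimately show "span (orbit v) = span ((\<lambda>i. (A ^^ i) v) ` {..<nilorder v})"
    by simp
qed (use assms funpow_nilorder image_in_orbit_span in auto)

lemma orbit_span_decompose:
  assumes "x \<in> span (orbit v)"
  obtains c z where "z \<in> span (orbit v)" and "x = c *s v + A z"
proof -
  have "orbit v \<subseteq> insert v (A ` orbit v)"
  proof
    fix y assume "y \<in> orbit v"
    then obtain i where "y = (A ^^ i) v"
      by (auto simp: orbit_def)
    then show "y \<in> insert v (A ` orbit v)"
      using funpow_in_orbit by (cases i) auto
  qed
  then have "x \<in> span (insert v (A ` orbit v))"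
    using assms span_mono by blast
  then obtain c where "x - c *s v \<in> A ` span (orbit v)"
    by (auto simp: span_breakdown_eq A.span_image)
  then obtain z where "z \<in> span (orbit v)" "x - c *s v = A z"
    by blast
  then show thesis
    using that[of z c] by (simp add: algebra_simps)
qed

text \<open>
  Write \<open>C\<close> for the cyclic subspace generated by \<open>v\<close>. Since \<open>C\<close> is spanned by \<open>v\<close> and \<open>A C\<close>, a vector
  \<open>y \<in> C\<close> outside \<open>A C\<close> may take the place of \<open>v\<close>, so \<open>C \<subseteq> M + A C\<close> as soon as \<open>y \<in> M\<close>. Iterating gives
  \<open>C \<subseteq> M + A\<^sup>n C\<close> for every \<open>n\<close>, and \<open>A\<^sup>n C\<close> eventually vanishes.
\<close>

lemma orbit_span_subset_if_not_in_image:
  assumes M: "subspace M" "\<And>n x. x \<in> M \<Longrightarrow> (A ^^ n) x \<in> M"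
    and y: "y \<in> M" "y \<in> span (orbit v)" "y \<notin> A ` span (orbit v)"
  shows "span (orbit v) \<subseteq> M"
proof -
  let ?C = "span (orbit v)"
  obtain c z where z: "z \<in> ?C" "y = c *s v + A z"
    using orbit_span_decompose[OF y(2)] .
  have "c \<noteq> 0"
    using y(3) z by auto
  have step: "\<exists>m\<in>M. \<exists>z\<in>?C. x = m + A z" if x: "x \<in> ?C" for x
  proof -
    obtain b z' where z': "z' \<in> ?C" "x = b *s v + A z'"
      using orbit_span_decompose[OF x] .
    \<comment> \<open>Solve \<open>y = c v + A z\<close> for \<open>v\<close> and substitute.\<close>
    have "x = (b / c) *s y + A (z' - (b / c) *s z)"
      using \<open>c \<noteq> 0\<close> z z'
      by (simp add: A.diff A.scale scale_right_distrib scale_right_diff_distrib)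
    moreover have "(b / c) *s y \<in> M"
      using M(1) y(1) by (rule subspace_scale)
    moreover have "z' - (b / c) *s z \<in> ?C"
      using z z' by (intro span_diff span_scale)
    ultimately show ?thesis by blast
  qed
  have "\<exists>m\<in>M. \<exists>z\<in>?C. x = m + (A ^^ n) z" if "x \<in> ?C" for x n
  proof (induction n)
    case 0
    show ?case
      using that subspace_0[OF M(1)] by (intro bexI[of _ 0] bexI[of _ x]) auto
  next
    case (Suc n)
    then obtain m z where mz: "m \<in> M" "z \<in> ?C" "x = m + (A ^^ n) z"
      by blast
    with step obtain m' z' where mz': "m' \<in> M" "z' \<in> ?C" "z = m' + A z'"
      by blast
    have "x = (m + (A ^^ n) m') + (A ^^ Suc n) z'"
      using mz mz' by (simp add: pow.add funpow_swap1 add.assoc)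
    moreover have "m + (A ^^ n) m' \<in> M"
      using M mz mz' by (intro subspace_add)
    ultimately show ?case
      using mz' by blast
  qed
  from this[of _ "nilorder v"] show ?thesis
    using funpow_orbit_span_eq_0[of _ v "nilorder v"] by fastforce
qed

section \<open>Generating sets of least total order\<close>

text \<open>Zero is excluded because it generates no cyclic subspace.\<close>

definition generates :: "'b set \<Rightarrow> bool" where
  "generates S \<longleftrightarrow> finite S \<and> 0 \<notin> S \<and> span (\<Union>v\<in>S. orbit v) = UNIV"

text \<open>
  The exchange step: a nontrivial relation between the cyclic subspaces yields, after dividing by the
  largest possible power of \<open>A\<close>, a vector that can replace one of the generators and has smaller
  order.
\<close>

lemma shorter_generating_set:
  assumes gen: "generates S"
    and u: "\<And>v. v \<in> S \<Longrightarrow> u v \<in> span (orbit v)" and sum_u: "(\<Sum>v\<in>S. u v) = 0"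
    and "i \<in> S" "u i \<noteq> 0"
  shows "\<exists>S'. generates S' \<and> sum nilorder S' < sum nilorder S"
proof -
  let ?div = "\<lambda>a. \<forall>v\<in>S. u v \<in> (A ^^ a) ` span (orbit v)"
  have S: "finite S" "0 \<notin> S" "span (\<Union>v\<in>S. orbit v) = UNIV"
    using gen by (auto simp: generates_def)
  obtain N where "(A ^^ N) x = 0" for x
    using nilpotent_A by (auto simp: nilpotent_map_def)
  with \<open>i \<in> S\<close> \<open>u i \<noteq> 0\<close> have "\<not> ?div N"
    by auto
  moreover have "?div 0"
    using u by auto
  ultimately obtain a where "?div a" "\<not> ?div (Suc a)"
    using inc_induct[of 0 N "\<lambda>n. \<not> ?div n"] by blast
  then obtain j where j: "j \<in> S" "u j \<notin> (A ^^ Suc a) ` span (orbit j)"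
    by blast
  from \<open>?div a\<close> have "\<forall>v\<in>S. \<exists>y. y \<in> span (orbit v) \<and> u v = (A ^^ a) y"
    by blast
  then obtain y where y: "\<And>v. v \<in> S \<Longrightarrow> y v \<in> span (orbit v)" "\<And>v. v \<in> S \<Longrightarrow> u v = (A ^^ a) (y v)"
    by metis
  define v' where "v' = (\<Sum>v\<in>S. y v)"
  \<comment> \<open>The new vector may be zero; then \<open>j\<close> is simply dropped.\<close>
  define S' where "S' = insert v' (S - {j}) - {0}"

  have "(A ^^ a) v' = 0"
    using sum_u y(2) by (simp add: v'_def pow.sum)
  then have "nilorder v' \<le> a"
    by (rule nilorder_le)
  moreover have "a < nilorder j"
  proof (rule ccontr)
    assume "\<not> a < nilorder j"
    then have "u j = 0"
      using funpow_orbit_span_eq_0[OF y(1)] y(2) j(1) by simp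
    then have "u j = (A ^^ Suc a) 0"
      by (simp add: pow.zero del: funpow.simps)
    with j(2) show False
      using span_zero by blast
  qed
  moreover have "sum nilorder S' \<le> nilorder v' + sum nilorder (S - {j})"
  proof -
    have "sum nilorder S' \<le> sum nilorder (insert v' (S - {j}))"
      using S(1) by (intro sum_mono2) (auto simp: S'_def)
    also have "\<dots> \<le> nilorder v' + sum nilorder (S - {j})"
      using S(1) by (simp add: sum.insert_if)
    finally show ?thesis .
  qed
  moreover have "sum nilorder S = nilorder j + sum nilorder (S - {j})"
    using S(1) j(1) by (rule sum.remove)
  ultimately have smaller: "sum nilorder S' < sum nilorder S"
    by simp

  let ?M = "span (\<Union>v\<in>S'. orbit v)"
  have old: "span (orbit v) \<subseteq> ?M" if "v \<in> S - {j}" for v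
    using that S(2) by (intro span_mono) (auto simp: S'_def)
  have "v' \<in> ?M"
  proof (cases "v' = 0")
    case False
    then have "span (orbit v') \<subseteq> ?M"
      by (intro span_mono) (auto simp: S'_def)
    then show ?thesis
      using self_in_orbit_span by blast
  qed (simp add: span_zero)
  moreover have "(\<Sum>v\<in>S - {j}. y v) \<in> ?M"
    using old y(1) by (intro span_sum) blast
  moreover have "y j = v' - (\<Sum>v\<in>S - {j}. y v)"
    using S(1) j(1) by (simp add: v'_def sum.remove)
  ultimately have "y j \<in> ?M"
    by (simp add: span_diff)
  moreover have "y j \<notin> A ` span (orbit j)"
    using j y(2) by (auto simp: funpow_swap1)
  ultimately have "span (orbit j) \<subseteq> ?M"
    using y(1)[OF j(1)]
    by (intro orbit_span_subset_if_not_in_image) (auto intro: funpow_in_span_orbits)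
  with old have "span (orbit v) \<subseteq> ?M" if "v \<in> S" for v
    using that by blast
  then have "(\<Union>v\<in>S. orbit v) \<subseteq> ?M"
    using span_superset by blast
  then have "span (\<Union>v\<in>S. orbit v) \<subseteq> ?M"
    by (simp add: span_minimal)
  with S have "generates S'"
    by (auto simp: generates_def S'_def)
  with smaller show ?thesis by blast
qed

lemma ex_independent_generating_set:
  assumes "finite B" and "span B = UNIV"
  obtains S where "generates S"
    and "\<And>u v. (\<And>v. v \<in> S \<Longrightarrow> u v \<in> span (orbit v)) \<Longrightarrow> (\<Sum>v\<in>S. u v) = 0 \<Longrightarrow> v \<in> S \<Longrightarrow> u v = 0"
proof -
  have "B - {0} \<subseteq> (\<Union>v\<in>B - {0}. orbit v)"
    using funpow_in_orbit[of 0] by fastforce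
  then have "span (B - {0}) \<subseteq> span (\<Union>v\<in>B - {0}. orbit v)"
    by (rule span_mono)
  with assms have "generates (B - {0})"
    by (auto simp: generates_def)
  then obtain S where "generates S" and "\<forall>S'. generates S' \<longrightarrow> sum nilorder S \<le> sum nilorder S'"
    using ex_has_least_nat[of generates _ "sum nilorder"] by blast
  \<comment> \<open>A nontrivial relation would give a generating set of smaller total order.\<close>
  with that shorter_generating_set[of S] show thesis
    by (metis not_le)
qed

theorem cyclic_decomposition:
  assumes "finite B" and "span B = UNIV"
  shows "\<exists>(k::nat) W. direct_sum UNIV {..<k} W \<and> (\<forall>i<k. cyclic_subspace A (W i))"
proof -
  obtain S where S: "generates S"
    and indep: "\<And>u v. (\<And>v. v \<in> S \<Longrightarrow> u v \<in> span (orbit v)) \<Longrightarrow> (\<Sum>v\<in>S. u v) = 0 \<Longrightarrow> v \<in> S \<Longrightarrow> u v = 0"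
    using ex_independent_generating_set[OF assms] by blast
  have "finite S" "0 \<notin> S"
    using S by (auto simp: generates_def)
  obtain h where h: "bij_betw h {..<card S} S"
    using \<open>finite S\<close> ex_bij_betw_nat_finite atLeast0LessThan by metis
  \<comment> \<open>The inverse enumeration carries a relation between indices back to one between members of \<open>S\<close>.\<close>
  define g where "g = the_inv_into {..<card S} h"
  have hS: "h i \<in> S" and gh: "g (h i) = i" if "i < card S" for i
    using h that by (auto simp: g_def bij_betw_def the_inv_into_f_f)
  have hg: "h (g v) = v" and g_less: "g v < card S" if "v \<in> S" for v
  proof -
    show "h (g v) = v"
      unfolding g_def using h that by (rule f_the_inv_into_f_bij_betw)
    have "bij_betw g S {..<card S}"
      unfolding g_def using h by (rule bij_betw_the_inv_into)
    with that show "g v < card S"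
      by (auto simp: bij_betw_def)
  qed
  have "direct_sum UNIV {..<card S} (\<lambda>i. span (orbit (h i)))"
  proof (rule direct_sumI)
    fix x :: 'b
    have "x \<in> span (\<Union>v\<in>S. orbit v)"
      using S by (simp add: generates_def)
    then obtain w where w: "\<And>v. v \<in> S \<Longrightarrow> w v \<in> span (orbit v)" "x = (\<Sum>v\<in>S. w v)"
      using span_UN_sumE[OF \<open>finite S\<close>] by blast
    have "x = (\<Sum>i<card S. w (h i))"
      unfolding w(2) using h by (rule sum.reindex_bij_betw[symmetric])
    then show "\<exists>w. (\<forall>i\<in>{..<card S}. w i \<in> span (orbit (h i))) \<and> x = (\<Sum>i<card S. w i)"
      using w(1) hS by (intro exI[of _ "w \<circ> h"]) auto
  next
    fix u i
    assume u: "\<And>i. i \<in> {..<card S} \<Longrightarrow> u i \<in> span (orbit (h i))"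
      and sum_u: "(\<Sum>i<card S. u i) = 0" and i: "i \<in> {..<card S}"
    have "(\<Sum>v\<in>S. u (g v)) = (\<Sum>i<card S. u (g (h i)))"
      using h by (rule sum.reindex_bij_betw[symmetric])
    also have "\<dots> = 0"
      using sum_u gh by simp
    finally have "u (g (h i)) = 0"
      using u hg g_less hS i by (intro indep[of "u \<circ> g", unfolded comp_def]) (auto, metis)
    then show "u i = 0"
      using gh i by simp
  qed auto
  moreover have "\<forall>i<card S. cyclic_subspace A (span (orbit (h i)))"
    using cyclic_subspace_orbit_span hS \<open>0 \<notin> S\<close> by metis
  ultimately show ?thesis by blast
qed

end

theorem proposition3:
  fixes scale :: "'a::field \<Rightarrow> 'b::ab_group_add \<Rightarrow> 'b"
    and Basis :: "'b set"
    and A :: "'b \<Rightarrow> 'b"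
  assumes "finite_dimensional_vector_space scale Basis"
    and "Vector_Spaces.linear scale scale A"
    and "nilpotent_map A"
  shows "\<exists>(k::nat) (W :: nat \<Rightarrow> 'b set).
           vector_space.direct_sum scale UNIV {..<k} W \<and>
           (\<forall>i<k. vector_space.cyclic_subspace scale A (W i))"
proof -
  interpret V: finite_dimensional_vector_space scale Basis
    by fact
  interpret nilpotent_endomorphism scale A
    using assms(2,3) V.vector_space_axioms
    by (simp add: nilpotent_endomorphism_def nilpotent_endomorphism_axioms_def)
  show ?thesis
    using V.finite_Basis V.span_Basis by (rule cyclic_decomposition)
qed

end
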